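(* Let $k,a,m\in\mathbb{C}$ (such that all expressions below are defined), let $q$ be a positive integer, and let $n$ be a prime number with $n\neq q$. Then $$\sum_{p=0}^{n-1}\left(\log^k(a)-i^k\,2^{k+1}\,e^{\frac{2i(mn+\pi p q)}{n}}\,\Phi\!\left(-e^{2i\left(m+\frac{p\pi q}{n}\right)},\,-k,\,1-\tfrac{1}{2}i\log(a)\right)\right)$$ $$=\;n\left(\log^k(a)-2^{k+1}(in)^k\,e^{2imn}\,\Phi\!\left(-e^{2imn},\,-k,\,1-\frac{i\log(a)}{2n}\right)\right),$$ where $\Phi$ denotes the Hurwitz-Lerch zeta function.
   Context: The Hurwitz-Lerch zeta function $\Phi(z,s,v)$ is given by the series $\Phi(z,s,v)=\sum_{j=0}^{\infty}(v+j)^{-s}z^{j}$ for $|z|<1$, $v\neq 0,-1,-2,\dots$, and is continued analytically by its integral representation $\Phi(z,s,v)=\frac{1}{\Gamma(s)}\int_{0}^{\infty}\frac{t^{s-1}e^{-(v-1)t}}{e^{t}-z}\,dt$, valid for $\operatorname{Re}(v)>0$ and either $|z|\le 1$, $z\neq 1$, $\operatorname{Re}(s)>0$, or $z=1$, $\operatorname{Re}(s)>1$. Here $\log^k(a)$ means $(\log a)^k$, $i$ is the imaginary unit, and logarithms and complex powers take their principal values.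
   Formalization: The formal theorem additionally assumes that n is not 2 and that n does not divide q; without these the identity is false (e.g. k=0, a=e, e^{2im}=1/2, n=2, q=1 gives 10/3 on the left and 6/5 on the right). *)

theory Defs
  imports "HOL-Complex_Analysis.Complex_Analysis" "HOL-Computational_Algebra.Primes"
begin

definition lerch_series :: "complex \<Rightarrow> complex \<Rightarrow> complex \<Rightarrow> complex" where
  "lerch_series z s v = (\<Sum>j. (v + of_nat j) powr (- s) * z ^ j)"

definition lerch_integral :: "complex \<Rightarrow> complex \<Rightarrow> complex \<Rightarrow> complex" where
  "lerch_integral z s v = 1 / Gamma s *
     (LBINT t:{0<..}. complex_of_real t powr (s - 1) * exp (- (v - 1) * complex_of_real t)
                        / (exp (complex_of_real t) - z))"

definition lerch_cut :: "complex set" where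
  "lerch_cut = complex_of_real ` {1..}"

(* For fixed s and v, the holomorphic continuation of the power series in z from the unit disc
   to the complex plane cut along [1, infinity).  It is unique, the cut plane being connected. *)
definition lerch_continuation :: "complex \<Rightarrow> complex \<Rightarrow> complex \<Rightarrow> complex" where
  "lerch_continuation s v =
     (SOME f. f holomorphic_on (- lerch_cut) \<and> (\<forall>z\<in>ball 0 1. f z = lerch_series z s v))"

(* The first two cases are the classical formulas on their usual ranges; off the cut they agree
   with the continuation.  The last case supplies the remaining values, for instance
   norm z = 1 with Re s \<le> 0, or norm z > 1 off the cut. *)
definition hurwitz_lerch :: "complex \<Rightarrow> complex \<Rightarrow> complex \<Rightarrow> complex" where
  "hurwitz_lerch z s v =
     (if norm z < 1 then lerch_series z s v
      else if Re v > 0 \<and> (norm z \<le> 1 \<and> z \<noteq> 1 \<and> Re s > 0 \<or> z = 1 \<and> Re s > 1)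
        then lerch_integral z s v
      else lerch_continuation s v z)"

(* The branch point z = 1 is admitted only where the integral converges. *)
definition hurwitz_lerch_defined :: "complex \<Rightarrow> complex \<Rightarrow> complex \<Rightarrow> bool" where
  "hurwitz_lerch_defined z s v \<longleftrightarrow>
     v \<notin> \<int>\<^sub>\<le>\<^sub>0 \<and> (z \<notin> lerch_cut \<or> z = 1 \<and> Re s > 1 \<and> Re v > 0)"

end

theory Submission imports Defs begin

text \<open>
  With \<open>\<omega> = exp (2 \<pi> i q / n)\<close>, a primitive \<open>n\<close>-th root of unity, and \<open>w = - exp (2 i m)\<close>, the
  arguments on the left are \<open>\<omega> ^ p * w\<close> and, \<open>n\<close> being odd, the argument on the right is \<open>w ^ n\<close>.
  For \<open>norm w < 1\<close> the identity follows termwise from the power series, since summing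
  over \<open>p\<close> annihilates every power of \<open>w\<close> whose exponent is not divisible by \<open>n\<close>. Both sides are
  holomorphic in \<open>w\<close> on the set where \<open>w ^ n\<close> avoids the cut, which is star-shaped about \<open>0\<close>,
  so the identity extends there. This needs the continuation to exist for all \<open>s\<close> and \<open>v\<close>: the integral
  provides it for \<open>Re s > 0\<close> and \<open>Re v > 0\<close>, and two recurrences move \<open>s\<close> and \<open>v\<close> to the left.
  If \<open>w ^ n = 1\<close>, some \<open>\<omega> ^ p * w\<close> equals \<open>1\<close> too, so that \<open>Re s > 1\<close> and \<open>Re v > 0\<close> and the series
  converge absolutely on the unit circle.
\<close>

section \<open>Holomorphic dependence of integrals on a parameter\<close>

text \<open>Cauchy's inequality turns the local domination of \<open>f\<close> into a bound on its
  derivative in \<open>z\<close>, so the difference quotients are dominated by a multiple of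
  \<open>h\<close> and dominated convergence differentiates under the integral.\<close>

lemma holomorphic_on_integral_dominated:
  fixes f :: "complex \<Rightarrow> 'a \<Rightarrow> complex"
  assumes "open U"
    and meas: "\<And>z. z \<in> U \<Longrightarrow> f z \<in> borel_measurable M"
    and hol: "\<And>x. x \<in> space M \<Longrightarrow> (\<lambda>z. f z x) holomorphic_on U"
    and dom: "\<And>z. z \<in> U \<Longrightarrow> \<exists>r>0. \<exists>h. integrable M h \<and>
                 (\<forall>w\<in>ball z r \<inter> U. \<forall>x\<in>space M. norm (f w x) \<le> h x)"
  shows "(\<lambda>z. integral\<^sup>L M (f z)) holomorphic_on U"
proof (rule holomorphic_onI)
  fix z0 assume z0: "z0 \<in> U"
  obtain r0 h where "r0 > 0" and h: "integrable M h"
    and bound0: "\<forall>w\<in>ball z0 r0 \<inter> U. \<forall>x\<in>space M. norm (f w x) \<le> h x"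
    using dom[OF z0] by blast
  obtain r1 where "r1 > 0" "ball z0 r1 \<subseteq> U"
    using \<open>open U\<close> z0 openE by blast
  define r where "r = min r0 r1"
  have r: "r > 0" "ball z0 r \<subseteq> U"
    using \<open>r0 > 0\<close> \<open>r1 > 0\<close> \<open>ball z0 r1 \<subseteq> U\<close> by (auto simp: r_def)
  have bound: "norm (f w x) \<le> h x" if "w \<in> ball z0 r" "x \<in> space M" for w x
    using bound0 that r by (auto simp: r_def)
  have int: "integrable M (f w)" if "w \<in> ball z0 r" for w
    using bound[OF that] that r
    by (intro Bochner_Integration.integrable_bound[OF h] meas AE_I2) fastforce+
  define D where "D x = deriv (\<lambda>z. f z x) z0" for x
  \<comment> \<open>Discs of radius \<open>r/4\<close> about points of \<open>ball z0 (r/2)\<close>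
    stay inside \<open>ball z0 r\<close>; Cauchy's inequality on them produces the constant
    \<open>4 / r\<close>.\<close>
  have lip: "norm (f w x - f z0 x) \<le> 4 * h x / r * norm (w - z0)"
    if w: "w \<in> ball z0 (r/2)" and x: "x \<in> space M" for w x
  proof (rule field_differentiable_bound[of "ball z0 (r/2)" "\<lambda>z. f z x" "deriv (\<lambda>z. f z x)"])
    fix u assume u: "u \<in> ball z0 (r/2)"
    have sub: "cball u (r/4) \<subseteq> ball z0 r"
    proof
      fix y assume "y \<in> cball u (r/4)"
      hence "dist z0 u < r/2" "dist u y \<le> r/4" using u by auto
      thus "y \<in> ball z0 r" using dist_triangle[of z0 y u] r(1) by simp
    qed
    have hu: "(\<lambda>z. f z x) holomorphic_on cball u (r/4)"
      using hol[OF x] sub r(2) by (meson holomorphic_on_subset subset_trans)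
    show "((\<lambda>z. f z x) has_field_derivative deriv (\<lambda>z. f z x) u) (at u within ball z0 (r / 2))"
      using u r hol[OF x] \<open>open U\<close>
      by (intro has_field_derivative_at_within[OF holomorphic_derivI[of _ U]]) auto
    have "norm ((deriv ^^ 1) (\<lambda>z. f z x) u) \<le> fact 1 * h x / (r/4) ^ 1"
    proof (rule Cauchy_inequality)
      show "(\<lambda>z. f z x) holomorphic_on ball u (r/4)"
        using hu by (rule holomorphic_on_subset) auto
      show "continuous_on (cball u (r/4)) (\<lambda>z. f z x)"
        using hu by (rule holomorphic_on_imp_continuous_on)
      fix y assume "cmod (u - y) = r/4"
      hence "y \<in> cball u (r/4)" by (simp add: dist_norm)
      thus "cmod (f y x) \<le> h x" using sub x bound by blast
    qed (use r in auto)
    thus "cmod (deriv (\<lambda>z. f z x) u) \<le> 4 * h x / r"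
      by (simp add: mult.commute)
  qed (use w r in auto)
  have lim: "(\<lambda>i. (f (X i) x - f z0 x) / (X i - z0)) \<longlonglongrightarrow> D x"
    if X: "\<And>i. X i \<in> ball z0 (r/2) - {z0}" "X \<longlonglongrightarrow> z0" and x: "x \<in> space M" for X x
  proof -
    have "((\<lambda>z. f z x) has_field_derivative D x) (at z0 within ball z0 (r/2))"
      unfolding D_def using hol[OF x] \<open>open U\<close> z0
      by (intro has_field_derivative_at_within[OF holomorphic_derivI[of _ U]]) auto
    thus ?thesis
      using X unfolding has_field_derivative_iff tendsto_at_iff_sequentially
      by (auto simp: o_def)
  qed
  have "((\<lambda>z. integral\<^sup>L M (f z)) has_field_derivative integral\<^sup>L M D) (at z0 within ball z0 (r/2))"
    unfolding has_field_derivative_iff tendsto_at_iff_sequentially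
  proof (intro allI impI)
    fix X :: "nat \<Rightarrow> complex"
    assume X: "\<forall>i. X i \<in> ball z0 (r/2) - {z0}" "X \<longlonglongrightarrow> z0"
    have XU: "X i \<in> ball z0 r" "X i \<in> U" for i
      using X(1)[rule_format, of i] r by auto
    have m: "(\<lambda>x. (f (X i) x - f z0 x) / (X i - z0)) \<in> borel_measurable M" for i
      using meas[OF XU(2)[of i]] meas[OF z0] by simp
    have "(\<lambda>i. integral\<^sup>L M (\<lambda>x. (f (X i) x - f z0 x) / (X i - z0))) \<longlonglongrightarrow> integral\<^sup>L M D"
    proof (rule integral_dominated_convergence)
      show "D \<in> borel_measurable M"
        by (rule borel_measurable_LIMSEQ_metric[OF m lim]) (use X in auto)
      show "integrable M (\<lambda>x. 4 * h x / r)" using h by simp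
      show "AE x in M. (\<lambda>i. (f (X i) x - f z0 x) / (X i - z0)) \<longlonglongrightarrow> D x"
        by (intro AE_I2 lim) (use X in auto)
      fix i
      have "X i \<noteq> z0" using X(1) by auto
      thus "AE x in M. cmod ((f (X i) x - f z0 x) / (X i - z0)) \<le> 4 * h x / r"
        using lip[of "X i"] X(1) by (intro AE_I2) (simp add: norm_divide divide_le_eq)
    qed (rule m)
    moreover have "integral\<^sup>L M (\<lambda>x. (f (X i) x - f z0 x) / (X i - z0))
        = (integral\<^sup>L M (f (X i)) - integral\<^sup>L M (f z0)) / (X i - z0)" for i
      using int[OF XU(1)[of i]] int[of z0] r(1) by simp
    ultimately show "((\<lambda>y. (integral\<^sup>L M (f y) - integral\<^sup>L M (f z0)) / (y - z0)) \<circ> X)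
        \<longlonglongrightarrow> integral\<^sup>L M D"
      by (simp only: o_def)
  qed
  thus "(\<lambda>z. integral\<^sup>L M (f z)) field_differentiable at z0 within U"
    using r(1) field_differentiable_def has_field_derivative_at_within
    by (metis at_within_open centre_in_ball half_gt_zero open_ball)
qed

section \<open>Euler's integral for Gamma with a complex scale\<close>

text \<open>The kernel has the same norm as the classical Gamma integrand with denominator
  \<open>exp (Re w * t)\<close>, and Borel measurability carries integrability from
  \<open>lebesgue\<close> over to \<open>lborel\<close>.\<close>

lemma Gamma_kernel_integrable:
  assumes "Re s > 0" "Re w > 0"
  shows "set_integrable lborel {0<..} (\<lambda>t. of_real t powr (s - 1) * exp (- w * of_real t))"
proof -
  let ?f = "\<lambda>t. indicator {0<..} t *\<^sub>R (complex_of_real t powr (s - 1) / of_real (exp (Re w * t)))"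
  have "integrable lebesgue ?f"
    using absolutely_integrable_Gamma_integral[OF assms] unfolding set_integrable_def .
  moreover have m: "(\<lambda>t. indicator {0<..} t *\<^sub>R (complex_of_real t powr (s - 1) / of_real (exp (Re w * t))))
      \<in> borel_measurable borel"
    by (auto intro!: borel_measurable_continuous_on_indicator continuous_intros)
  ultimately have "integrable lborel ?f" by (subst (asm) integrable_completion) auto
  moreover have "(\<lambda>t. indicator {0<..} t *\<^sub>R (complex_of_real t powr (s - 1) * exp (- w * of_real t)))
      \<in> borel_measurable borel"
    by (auto intro!: borel_measurable_continuous_on_indicator continuous_intros)
  ultimately show ?thesis
    unfolding set_integrable_def
    by (elim Bochner_Integration.integrable_bound)
       (auto simp: norm_mult norm_divide exp_minus field_simps indicator_def)
qed

lemma Gamma_integral_scaled: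
  fixes x :: real
  assumes s: "Re s > 0" and x: "x > 0"
  shows "(LBINT t:{0<..}. of_real t powr (s - 1) * exp (- of_real x * of_real t))
      = Gamma s * of_real x powr (- s)"
proof -
  define g where "g t = indicator {0<..} t *\<^sub>R (complex_of_real t powr (s - 1) * exp (- of_real t))" for t
  have i1: "set_integrable lborel {0<..} (\<lambda>t. complex_of_real t powr (s - 1) * exp (- of_real t))"
    using Gamma_kernel_integrable[of s 1] s by simp
  have "integral\<^sup>L lborel g = integral {0<..} (\<lambda>t. complex_of_real t powr (s - 1) * exp (- of_real t))"
    using set_borel_integral_eq_integral(2)[OF i1] by (simp add: g_def[abs_def] set_lebesgue_integral_def)
  also have "\<dots> = Gamma s"
    using Gamma_integral_complex'[OF s]
    by (simp add: exp_minus exp_of_real divide_inverse integral_unique flip: of_real_minus)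
  finally have G: "integral\<^sup>L lborel g = Gamma s" .
  have "integral\<^sup>L lborel g = \<bar>x\<bar> *\<^sub>R (\<integral>t. g (0 + x * t) \<partial>lborel)"
    by (rule lborel_integral_real_affine) (use x in auto)
  also have "(\<lambda>t. g (0 + x * t)) = (\<lambda>t. of_real x powr (s - 1) *
      (indicator {0<..} t *\<^sub>R (complex_of_real t powr (s - 1) * exp (- of_real x * of_real t))))"
    using x by (auto simp: g_def indicator_def fun_eq_iff zero_less_mult_iff powr_times_real)
  finally have "Gamma s = of_real x * of_real x powr (s - 1) *
      (LBINT t:{0<..}. of_real t powr (s - 1) * exp (- of_real x * of_real t))"
    using x by (simp add: G set_lebesgue_integral_def scaleR_conv_of_real)
  also have "of_real x * of_real x powr (s - 1) = complex_of_real x powr s"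
    using x by (simp add: powr_diff)
  finally show ?thesis using x by (simp add: powr_minus field_simps)
qed

text \<open>Both sides are holomorphic in \<open>w\<close> on the right half-plane and agree for
  positive real \<open>w\<close>, where Euler's integral can be rescaled; the identity theorem does
  the rest.\<close>

lemma Gamma_integral_halfplane:
  assumes s: "Re s > 0" and w: "Re w > 0"
  shows "(LBINT t:{0<..}. of_real t powr (s - 1) * exp (- w * of_real t)) = Gamma s * w powr (- s)"
proof -
  let ?U = "{w. Re w > 0}"
  define k where "k w t = indicator {0<..} t *\<^sub>R (complex_of_real t powr (s - 1) * exp (- w * of_real t))"
    for w t
  have U: "open ?U" "connected ?U"
    by (auto simp: open_halfspace_Re_gt convex_halfspace_Re_gt intro!: convex_connected)
  have "(\<lambda>w. integral\<^sup>L lborel (k w)) holomorphic_on ?U"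
  proof (rule holomorphic_on_integral_dominated[OF U(1)])
    fix z assume "z \<in> ?U"
    hence z: "Re z > 0" by simp
    \<comment> \<open>Every \<open>w\<close> in \<open>ball z (Re z / 2)\<close> has real part at
      least \<open>Re z / 2\<close>, so the kernel at that real number dominates.\<close>
    define h where "h t = norm (k (of_real (Re z / 2)) t)" for t
    have "integrable lborel h"
      using Gamma_kernel_integrable[OF s, of "of_real (Re z / 2)"] z
      unfolding h_def k_def set_integrable_def by (intro integrable_norm) simp
    moreover have "norm (k w t) \<le> h t" if "w \<in> ball z (Re z / 2)" for w t
    proof -
      have "Re z - Re w < Re z / 2"
        using that complex_Re_le_cmod[of "z - w"] by (simp add: dist_norm)
      hence "Re z / 2 \<le> Re w" by simp
      hence "t > 0 \<Longrightarrow> Re z / 2 * t \<le> Re w * t" by (intro mult_right_mono) auto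
      thus ?thesis by (auto simp: h_def k_def indicator_def norm_mult intro!: mult_left_mono)
    qed
    ultimately show "\<exists>r>0. \<exists>h. integrable lborel h \<and>
        (\<forall>w\<in>ball z r \<inter> ?U. \<forall>t\<in>space lborel. norm (k w t) \<le> h t)"
      using z by (intro exI[of _ "Re z / 2"]) auto
  next
    fix z show "k z \<in> borel_measurable lborel"
      unfolding k_def
      by (auto intro!: borel_measurable_continuous_on_indicator continuous_intros)
  next
    fix t show "(\<lambda>w. k w t) holomorphic_on ?U"
      unfolding k_def by (auto intro!: holomorphic_intros simp: scaleR_conv_of_real)
  qed
  moreover have "(\<lambda>w. Gamma s * w powr (- s)) holomorphic_on ?U"
    by (auto intro!: holomorphic_intros simp: complex_nonpos_Reals_iff)
  ultimately have hol: "(\<lambda>w. integral\<^sup>L lborel (k w) - Gamma s * w powr (- s)) holomorphic_on ?U"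
    by (rule holomorphic_on_diff)
  have "integral\<^sup>L lborel (k w) - Gamma s * w powr (- s) = 0"
  proof (rule analytic_continuation[OF hol U, of "complex_of_real ` {0<..}" 1])
    have "(1::real) islimpt {0<..}"
      by (simp add: open_imp_islimpt)
    thus "1 islimpt complex_of_real ` {0<..}"
      using islimpt_isCont_image[of "1::real" "{0<..}" complex_of_real]
      by (auto simp: eventually_at_filter)
    fix z assume "z \<in> complex_of_real ` {0<..}"
    thus "integral\<^sup>L lborel (k z) - Gamma s * z powr (- s) = 0"
      using Gamma_integral_scaled[OF s] by (auto simp: k_def[abs_def] set_lebesgue_integral_def)
  qed (use w in auto)
  thus ?thesis by (simp add: k_def[abs_def] set_lebesgue_integral_def)
qed

section \<open>The cut plane and continuations of the series\<close>

definition lerch_term :: "complex \<Rightarrow> complex \<Rightarrow> complex \<Rightarrow> nat \<Rightarrow> complex" where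
  "lerch_term s v z j = (v + of_nat j) powr (- s) * z ^ j"

text \<open>Asking for \<open>sums\<close> rather than for equality with \<open>lerch_series\<close>
  also records convergence, on which the termwise recurrences rely.\<close>

definition continues_lerch :: "complex \<Rightarrow> complex \<Rightarrow> (complex \<Rightarrow> complex) \<Rightarrow> bool" where
  "continues_lerch s v f \<longleftrightarrow>
     f holomorphic_on - lerch_cut \<and> (\<forall>z\<in>ball 0 1. lerch_term s v z sums f z)"

lemma in_lerch_cut_iff: "z \<in> lerch_cut \<longleftrightarrow> Im z = 0 \<and> Re z \<ge> 1"
  unfolding lerch_cut_def
  by (auto simp: complex_eq_iff image_iff Bex_def)

lemma closed_lerch_cut: "closed lerch_cut"
proof -
  have "lerch_cut = {z. Im z = 0} \<inter> {z. Re z \<ge> 1}"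
    by (auto simp: in_lerch_cut_iff)
  also have "closed \<dots>"
    by (intro closed_Int closed_Collect_eq closed_Collect_le continuous_intros)
  finally show ?thesis .
qed

lemma norm_ge_1_if_in_lerch_cut: "z \<in> lerch_cut \<Longrightarrow> norm z \<ge> 1"
  using complex_Re_le_cmod[of z] by (auto simp: in_lerch_cut_iff)

text \<open>If \<open>0 \<le> u \<le> 1\<close> and \<open>(u * w) ^ n\<close> is real and at least
  1, then so is \<open>w ^ n\<close>, because \<open>u ^ n\<close> is real, positive and at most 1.
  Hence the set is star-shaped about 0. For \<open>n = 1\<close> it is the cut plane itself.\<close>

lemma power_not_in_lerch_cut:
  assumes "n > 0"
  shows "open {w. w ^ n \<notin> lerch_cut}" (is "open ?U")
    and "connected {w. w ^ n \<notin> lerch_cut}"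
    and "ball 0 1 \<subseteq> {w. w ^ n \<notin> lerch_cut}"
proof -
  have "open ((\<lambda>w. w ^ n) -` (- lerch_cut))"
    by (intro open_vimage continuous_intros) (auto simp: closed_lerch_cut)
  thus "open ?U" by (simp add: vimage_def)
  show ball: "ball 0 1 \<subseteq> ?U"
  proof safe
    fix w :: complex assume "w \<in> ball 0 1" "w ^ n \<in> lerch_cut"
    thus False
      using norm_ge_1_if_in_lerch_cut[of "w ^ n"] power_less_one_iff[of "norm w" n] assms
      by (simp add: norm_power)
  qed
  have "closed_segment 0 w \<subseteq> ?U" if w: "w \<in> ?U" for w
  proof safe
    fix x assume "x \<in> closed_segment 0 w" and c: "x ^ n \<in> lerch_cut"
    then obtain u where u: "0 \<le> u" "u \<le> 1" "x = of_real u * w"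
      by (auto simp: closed_segment_def scaleR_conv_of_real)
    have e: "x ^ n = of_real (u ^ n) * w ^ n" by (simp add: u(3) power_mult_distrib)
    have un: "0 \<le> u ^ n" "u ^ n \<le> 1" using u by (simp_all add: power_le_one)
    have "x \<noteq> 0" using norm_ge_1_if_in_lerch_cut[OF c] assms by (auto simp: zero_power)
    hence "u \<noteq> 0" using u(3) by auto
    hence "u ^ n \<noteq> 0" by simp
    moreover have "u ^ n * Re (w ^ n) \<ge> 1" "u ^ n * Im (w ^ n) = 0"
      using c unfolding e in_lerch_cut_iff by auto
    moreover from this(1) have "Re (w ^ n) > 0"
      using un(1) by (smt (verit) mult_nonneg_nonpos)
    hence "u ^ n * Re (w ^ n) \<le> Re (w ^ n)" using un by (simp add: mult_left_le_one_le)
    ultimately show False using w by (auto simp: in_lerch_cut_iff)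
  qed
  hence "starlike ?U" unfolding starlike_def
    using subsetD[OF ball, of 0] by (intro bexI[of _ 0]) auto
  thus "connected ?U" by (rule starlike_imp_connected)
qed

lemma eq_on_power_not_in_lerch_cut:
  assumes "n > 0"
    and "f holomorphic_on {w. w ^ n \<notin> lerch_cut}" "g holomorphic_on {w. w ^ n \<notin> lerch_cut}"
    and "\<And>w. w \<in> ball 0 1 \<Longrightarrow> f w = g w"
    and "w ^ n \<notin> lerch_cut"
  shows "f w = g w"
proof (rule analytic_continuation_open[of "ball 0 1" "{w. w ^ n \<notin> lerch_cut}" f g w])
qed (use assms power_not_in_lerch_cut[OF assms(1)] in auto)

lemma open_Compl_lerch_cut: "open (- lerch_cut)"
  using closed_lerch_cut by (rule open_Compl)

section \<open>The integral representation and its series\<close>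

text \<open>With \<open>u = exp (- t)\<close> the difference equals
  \<open>exp t * (1 - w * u)\<close>. On the compact interval \<open>{0..1}\<close> the norm of
  \<open>1 - z * u\<close> has a positive minimum, since a zero would make \<open>z = 1 / u\<close>
  a point of the cut. Half of this minimum is the bound, the other half absorbs the move from
  \<open>z\<close> to \<open>w\<close>.\<close>

lemma norm_exp_diff_ge:
  assumes "z \<notin> lerch_cut"
  obtains d where "d > 0"
    "\<And>w t. w \<in> ball z d \<Longrightarrow> t > 0 \<Longrightarrow> d * exp t \<le> norm (exp (complex_of_real t) - w)"
proof -
  obtain u0 where u0: "u0 \<in> {0..1}" "\<And>u. u \<in> {0..1} \<Longrightarrow> norm (1 - z * of_real u0) \<le> norm (1 - z * of_real u)"
    using continuous_attains_inf[of "{0..1::real}" "\<lambda>u. norm (1 - z * of_real u)"]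
    by (force intro: continuous_intros)
  define d where "d = norm (1 - z * of_real u0) / 2"
  have "1 - z * of_real u0 \<noteq> 0"
  proof
    assume "1 - z * of_real u0 = 0"
    moreover from this have "u0 \<noteq> 0" by auto
    ultimately have "z = of_real (1 / u0)" "1 / u0 \<ge> 1" using u0(1) by (auto simp: field_simps)
    thus False using assms by (auto simp: lerch_cut_def simp del: of_real_divide)
  qed
  hence d: "d > 0" by (simp add: d_def)
  have "d * exp t \<le> norm (exp (complex_of_real t) - w)" if w: "w \<in> ball z d" and t: "t > 0" for w t
  proof -
    define u where "u = exp (- t)"
    have u: "0 < u" "u \<le> 1" using t by (auto simp: u_def)
    have "2 * d \<le> norm (1 - z * of_real u)" using u0(2)[of u] u by (simp add: d_def)
    also have "\<dots> = norm ((1 - w * of_real u) + (w - z) * of_real u)" by (simp add: algebra_simps)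
    also have "\<dots> \<le> norm (1 - w * of_real u) + norm (w - z) * u"
      using u norm_triangle_ineq[of "1 - w * of_real u" "(w - z) * of_real u"] by (simp add: norm_mult)
    also have "norm (w - z) * u \<le> d * 1"
      using u w d by (intro mult_mono) (auto simp: dist_norm norm_minus_commute)
    finally have "d * exp t \<le> norm (1 - w * of_real u) * exp t" by simp
    also have "\<dots> = norm ((1 - w * of_real u) * of_real (exp t))" by (simp add: norm_mult)
    also have "(1 - w * of_real u) * of_real (exp t) = exp (complex_of_real t) - w"
      by (simp add: u_def algebra_simps exp_of_real flip: exp_add of_real_mult)
    finally show ?thesis .
  qed
  thus ?thesis using d that by blast
qed

text \<open>The indicator is part of the kernel, so that the set integral becomes a plain integral
  over \<open>lborel\<close> and the results on dominated integrals apply.\<close>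

definition lerch_kernel :: "complex \<Rightarrow> complex \<Rightarrow> complex \<Rightarrow> real \<Rightarrow> complex" where
  "lerch_kernel s v z t = indicator {0<..} t *\<^sub>R
     (of_real t powr (s - 1) * exp (- (v - 1) * of_real t) / (exp (of_real t) - z))"

lemma lerch_integral_altdef: "lerch_integral z s v = 1 / Gamma s * integral\<^sup>L lborel (lerch_kernel s v z)"
  by (simp add: lerch_integral_def lerch_kernel_def[abs_def] set_lebesgue_integral_def)

lemma lerch_integral_holomorphic:
  assumes s: "Re s > 0" and v: "Re v > 0"
  shows "(\<lambda>z. lerch_integral z s v) holomorphic_on - lerch_cut"
proof -
  have nz: "exp (complex_of_real t) \<noteq> z" if "z \<notin> lerch_cut" "t > 0" for z t
    using that by (auto simp: lerch_cut_def exp_of_real)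
  have "(\<lambda>z. integral\<^sup>L lborel (lerch_kernel s v z)) holomorphic_on - lerch_cut"
  proof (rule holomorphic_on_integral_dominated[OF open_Compl_lerch_cut])
    fix z assume z: "z \<in> - lerch_cut"
    have "lerch_kernel s v z \<in> borel_measurable borel"
      unfolding lerch_kernel_def
      by (intro borel_measurable_continuous_on_indicator continuous_intros)
         (use z nz in auto)
    thus "lerch_kernel s v z \<in> borel_measurable lborel" by simp
    obtain d where d: "d > 0"
      "\<And>w t. w \<in> ball z d \<Longrightarrow> t > 0 \<Longrightarrow> d * exp t \<le> norm (exp (complex_of_real t) - w)"
      using norm_exp_diff_ge z by (metis ComplD)
    \<comment> \<open>Dividing by the lower bound \<open>d * exp t\<close> turns
      \<open>exp (- (v - 1) * t)\<close> into \<open>exp (- v * t)\<close>, which leaves an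
      integrable Gamma kernel.\<close>
    define g where "g t = norm (indicator {0<..} t *\<^sub>R
        (complex_of_real t powr (s - 1) * exp (- v * of_real t))) / d" for t
    have "integrable lborel g"
      using Gamma_kernel_integrable[OF assms] unfolding set_integrable_def g_def
      by (intro integrable_divide integrable_norm)
    moreover have "norm (lerch_kernel s v w t) \<le> g t" if "w \<in> ball z d" for w t
    proof (cases "t > 0")
      case True
      let ?A = "t powr (Re s - 1) * exp (- (Re v - 1) * t)"
      have "norm (lerch_kernel s v w t) = ?A / norm (exp (of_real t) - w)"
        using True by (simp add: lerch_kernel_def norm_mult norm_divide norm_powr_real_powr)
      also have "\<dots> \<le> ?A / (d * exp t)"
        using d(1) d(2)[OF that True] less_le_trans[OF _ d(2)[OF that True], of 0]
        by (intro divide_left_mono mult_pos_pos) auto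
      also have "?A / (d * exp t) = g t"
      proof -
        have "exp (- (Re v - 1) * t) = exp (- Re v * t) * exp t"
          by (simp add: algebra_simps flip: exp_add)
        thus ?thesis
          using True by (simp add: g_def norm_mult norm_powr_real_powr)
      qed
      finally show ?thesis .
    qed (simp add: lerch_kernel_def g_def)
    ultimately show "\<exists>r>0. \<exists>h. integrable lborel h \<and>
        (\<forall>w\<in>ball z r \<inter> - lerch_cut. \<forall>t\<in>space lborel. norm (lerch_kernel s v w t) \<le> h t)"
      using d(1) by (intro exI[of _ d] conjI exI[of _ g]) auto
  next
    fix t show "(\<lambda>z. lerch_kernel s v z t) holomorphic_on - lerch_cut"
      unfolding lerch_kernel_def
      by (cases "t > 0") (auto intro!: holomorphic_intros simp: nz)
  qed
  thus ?thesis unfolding lerch_integral_altdef by (intro holomorphic_intros)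
qed

text \<open>Expanding \<open>1 / (exp t - z)\<close> as a geometric series in
  \<open>z * exp (- t)\<close> and integrating term by term gives Gamma integrals. The assumption
  \<open>sm\<close> is the absolute convergence that justifies the exchange, also on the unit
  circle.\<close>

lemma lerch_term_sums_integral:
  assumes s: "Re s > 0" and v: "Re v > 0" and z: "norm z \<le> 1"
    and sm: "summable (\<lambda>j. norm z ^ j * (Re v + of_nat j) powr (- Re s))"
  shows "lerch_term s v z sums lerch_integral z s v"
proof -
  define F where "F j t = z ^ j * (indicator {0<..} t *\<^sub>R
      (complex_of_real t powr (s - 1) * exp (- (v + of_nat j) * of_real t)))" for j t
  have vj: "Re (v + of_nat j) > 0" for j using v by simp
  have int: "integrable lborel (F j)" for j
    using Gamma_kernel_integrable[OF s vj] unfolding set_integrable_def F_def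
    by (intro integrable_mult_right)
  have geo: "(\<lambda>j. F j t) sums lerch_kernel s v z t" for t
  proof (cases "t > 0")
    case True
    define c where "c = z * of_real (exp (- t))"
    have "norm c \<le> 1 * exp (- t)"
      using z unfolding c_def norm_mult by (intro mult_mono) auto
    also have "\<dots> < 1" using True by simp
    finally have c: "norm c < 1" .
    hence c1: "c \<noteq> 1" by auto
    define A where "A = complex_of_real t powr (s - 1) * exp (- v * of_real t)"
    have "(\<lambda>j. A * c ^ j) sums (A * (1 / (1 - c)))"
      using geometric_sums[OF c] by (rule sums_mult)
    also have "(\<lambda>j. A * c ^ j) = (\<lambda>j. F j t)"
    proof
      fix j
      have "complex_of_real (exp (- t)) ^ j = exp (of_nat j * - complex_of_real t)"
        by (simp only: exp_of_nat_mult exp_of_real[symmetric] of_real_minus)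
      hence "exp (- v * of_real t) * complex_of_real (exp (- t)) ^ j = exp (- (v + of_nat j) * of_real t)"
        by (simp add: algebra_simps flip: exp_add)
      thus "A * c ^ j = F j t"
        using True by (simp add: A_def F_def c_def power_mult_distrib mult_ac)
    qed
    also have "A * (1 / (1 - c)) = lerch_kernel s v z t"
    proof -
      have "exp (of_real t) - z = exp (of_real t) * (1 - c)"
        by (simp add: c_def algebra_simps exp_minus flip: exp_of_real)
      moreover have "exp (- (v - 1) * of_real t) = exp (- v * of_real t) * exp (of_real t)"
        by (simp add: algebra_simps flip: exp_add)
      ultimately show ?thesis
        using True c1 by (simp add: lerch_kernel_def A_def)
    qed
    finally show ?thesis .
  qed (simp add: F_def lerch_kernel_def)
  have nF: "norm (F j t) = norm z ^ j * norm (indicator {0<..} t *\<^sub>R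
      (complex_of_real t powr (s - 1) * exp (- (v + of_nat j) * of_real t)))" for j t
    by (simp add: F_def norm_mult norm_power)
  \<comment> \<open>Taking norms replaces \<open>s\<close> and \<open>v + j\<close> by their real
    parts, so the integral is again a Gamma integral. It is computed over the complex numbers and
    read off by taking norms.\<close>
  have int_norm: "(\<integral>t. norm (F j t) \<partial>lborel)
      = norm (Gamma (of_real (Re s) :: complex)) * (norm z ^ j * (Re v + of_nat j) powr (- Re s))" for j
  proof -
    have "of_real (\<integral>t. norm (F j t) \<partial>lborel) = (\<integral>t. complex_of_real (norm (F j t)) \<partial>lborel)"
      by (rule integral_complex_of_real[symmetric])
    also have "(\<lambda>t. complex_of_real (norm (F j t))) = (\<lambda>t. of_real (norm z ^ j) * (indicator {0<..} t *\<^sub>R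
        (complex_of_real t powr (of_real (Re s) - 1) * exp (- of_real (Re v + of_nat j) * of_real t))))"
    proof
      fix t show "complex_of_real (norm (F j t)) = of_real (norm z ^ j) * (indicator {0<..} t *\<^sub>R
        (complex_of_real t powr (of_real (Re s) - 1) * exp (- of_real (Re v + of_nat j) * of_real t)))"
      proof (cases "t > 0")
        case True
        have "complex_of_real t powr (of_real (Re s) - 1) = of_real (t powr (Re s - 1))"
          using True powr_of_real[of t "Re s - 1"] by simp
        moreover have "exp (- complex_of_real (Re v + of_nat j) * of_real t)
            = of_real (exp (- (Re v + of_nat j) * t))"
          by (simp only: exp_of_real of_real_minus of_real_mult flip: exp_of_real)
        ultimately show ?thesis using True
          by (simp add: nF norm_mult norm_powr_real_powr)
      qed (simp add: nF)
    qed
    also have "(\<integral>t. of_real (norm z ^ j) * (indicator {0<..} t *\<^sub>R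
        (complex_of_real t powr (of_real (Re s) - 1) * exp (- of_real (Re v + of_nat j) * of_real t))) \<partial>lborel)
      = of_real (norm z ^ j) * (Gamma (of_real (Re s)) * of_real (Re v + of_nat j) powr (- of_real (Re s)))"
      using Gamma_integral_scaled[of "of_real (Re s)" "Re v + of_nat j"] s vj[of j]
      by (subst integral_mult_right_zero) (simp add: set_lebesgue_integral_def)
    finally have "norm (complex_of_real (\<integral>t. norm (F j t) \<partial>lborel))
      = norm (of_real (norm z ^ j) * (Gamma (of_real (Re s)) * complex_of_real (Re v + of_nat j) powr (- of_real (Re s))))"
      by (rule arg_cong)
    also have "norm (complex_of_real (Re v + of_nat j) powr (- of_real (Re s))) = (Re v + of_nat j) powr (- Re s)"
      using v by (subst norm_powr_real_powr) auto
    hence "norm (of_real (norm z ^ j) * (Gamma (of_real (Re s)) * complex_of_real (Re v + of_nat j) powr (- of_real (Re s))))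
      = norm (Gamma (of_real (Re s) :: complex)) * (norm z ^ j * (Re v + of_nat j) powr (- Re s))"
      by (simp add: norm_mult norm_power del: of_real_add)
    moreover have "norm (complex_of_real (\<integral>t. norm (F j t) \<partial>lborel)) = (\<integral>t. norm (F j t) \<partial>lborel)"
      by (simp add: integral_nonneg_AE)
    ultimately show ?thesis by simp
  qed
  have "(\<lambda>j. integral\<^sup>L lborel (F j)) sums (\<integral>t. (\<Sum>j. F j t) \<partial>lborel)"
  proof (rule sums_integral)
    show "AE t in lborel. summable (\<lambda>j. norm (F j t))"
    proof (intro AE_I2)
      fix t :: real
      show "summable (\<lambda>j. norm (F j t))"
      proof (cases "t > 0")
        case True
        define c where "c = norm z * exp (- t)"
        have "c \<le> 1 * exp (- t)"
          using z unfolding c_def by (intro mult_mono) auto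
        also have "\<dots> < 1" using True by simp
        finally have "norm c < 1" by (simp add: c_def)
        hence "summable (\<lambda>j. t powr (Re s - 1) * exp (- Re v * t) * c ^ j)"
          by (intro summable_mult summable_geometric)
        also have "(\<lambda>j. t powr (Re s - 1) * exp (- Re v * t) * c ^ j) = (\<lambda>j. norm (F j t))"
          using True by (auto simp: nF c_def fun_eq_iff power_mult_distrib norm_mult norm_powr_real_powr
              algebra_simps simp flip: exp_of_nat_mult exp_add)
        finally show ?thesis .
      qed (simp add: F_def)
    qed
    show "summable (\<lambda>j. \<integral>t. norm (F j t) \<partial>lborel)"
      unfolding int_norm by (intro summable_mult sm)
  qed (rule int)
  also have "(\<lambda>t. \<Sum>j. F j t) = lerch_kernel s v z"
    using geo by (auto simp: sums_iff)
  also have "(\<lambda>j. integral\<^sup>L lborel (F j)) = (\<lambda>j. Gamma s * lerch_term s v z j)"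
  proof
    fix j
    show "integral\<^sup>L lborel (F j) = Gamma s * lerch_term s v z j"
      using Gamma_integral_halfplane[OF s vj[of j]]
      unfolding F_def[abs_def] lerch_term_def
      by (subst integral_mult_right_zero) (simp add: set_lebesgue_integral_def)
  qed
  finally have "(\<lambda>j. 1 / Gamma s * (Gamma s * lerch_term s v z j)) sums lerch_integral z s v"
    unfolding lerch_integral_altdef by (rule sums_mult)
  moreover have "Gamma s \<noteq> 0"
    using s by (auto simp: Gamma_eq_zero_iff elim!: nonpos_Ints_cases)
  ultimately show ?thesis by simp
qed

lemma continues_lerch_integral:
  assumes s: "Re s > 0" and v: "Re v > 0"
  shows "continues_lerch s v (\<lambda>z. lerch_integral z s v)"
  unfolding continues_lerch_def
proof (intro conjI ballI)
  fix z :: complex assume z: "z \<in> ball 0 1"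
  show "lerch_term s v z sums lerch_integral z s v"
  proof (rule lerch_term_sums_integral[OF s v])
    show "summable (\<lambda>j. norm z ^ j * (Re v + of_nat j) powr (- Re s))"
    proof (rule summable_comparison_test')
      show "summable (\<lambda>j. norm z ^ j * Re v powr (- Re s))"
        using z by (intro summable_mult2 summable_geometric) auto
      fix j :: nat
      show "norm (norm z ^ j * (Re v + of_nat j) powr (- Re s)) \<le> norm z ^ j * Re v powr (- Re s)"
        using s v by (auto intro!: mult_left_mono powr_mono2' simp: abs_mult)
    qed
  qed (use z in auto)
qed (rule lerch_integral_holomorphic[OF assms])

text \<open>The terms are bounded by those of the convergent series of
  \<open>j powr (- Re s)\<close>. This covers the branch point \<open>z = 1\<close>, which
  continuation in \<open>z\<close> does not reach.\<close>

lemma lerch_term_sums_integral_circle: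
  assumes "Re s > 1" "Re v > 0" "norm z = 1"
  shows "lerch_term s v z sums lerch_integral z s v"
proof (rule lerch_term_sums_integral)
  show "summable (\<lambda>j. norm z ^ j * (Re v + of_nat j) powr (- Re s))"
  proof (rule summable_comparison_test')
    show "summable (\<lambda>j. real j powr (- Re s))" using assms by (simp add: summable_real_powr_iff)
    \<comment> \<open>The majorant is 0 at \<open>j = 0\<close>, so the comparison starts at
      1.\<close>
    fix j :: nat assume "j \<ge> 1"
    thus "norm (norm z ^ j * (Re v + of_nat j) powr (- Re s)) \<le> real j powr (- Re s)"
      using assms by (auto intro!: powr_mono2')
  qed
qed (use assms in auto)

section \<open>Existence of the continuation for all parameters\<close>

text \<open>Splitting off the term \<open>j = 0\<close> leaves \<open>z\<close> times the series at
  \<open>v + 1\<close>. This moves existence to the left in \<open>v\<close>.\<close>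

lemma continues_lerch_shift_v:
  assumes "continues_lerch s (v + 1) f"
  shows "continues_lerch s v (\<lambda>z. v powr (- s) + z * f z)"
  unfolding continues_lerch_def
proof (intro conjI ballI)
  show "(\<lambda>z. v powr (- s) + z * f z) holomorphic_on - lerch_cut"
    using assms by (auto simp: continues_lerch_def intro!: holomorphic_intros)
  fix z :: complex assume "z \<in> ball 0 1"
  hence "(\<lambda>j. z * lerch_term s (v + 1) z j) sums (z * f z)"
    using assms by (auto simp: continues_lerch_def intro!: sums_mult)
  also have "(\<lambda>j. z * lerch_term s (v + 1) z j) = (\<lambda>j. lerch_term s v z (Suc j))"
    by (simp add: lerch_term_def fun_eq_iff algebra_simps)
  finally show "lerch_term s v z sums (v powr (- s) + z * f z)"
    using sums_Suc[of "lerch_term s v z" "z * f z"] by (simp add: lerch_term_def add.commute)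
qed

text \<open>The operator \<open>v + z d/dz\<close> lowers \<open>s\<close> by one, termwise and hence for the continuation.\<close>

lemma continues_lerch_shift_s:
  assumes "continues_lerch (s + 1) v f"
  shows "continues_lerch s v (\<lambda>z. v * f z + z * deriv f z)"
  unfolding continues_lerch_def
proof (intro conjI ballI)
  have hol: "f holomorphic_on - lerch_cut" and
    sums: "\<And>z. norm z < 1 \<Longrightarrow> (\<lambda>j. (v + of_nat j) powr (- (s + 1)) * z ^ j) sums f z"
    using assms by (auto simp: continues_lerch_def lerch_term_def[abs_def])
  show "(\<lambda>z. v * f z + z * deriv f z) holomorphic_on - lerch_cut"
    using hol open_Compl_lerch_cut by (intro holomorphic_intros)
  fix z :: complex assume "z \<in> ball 0 1"
  hence z: "norm z < 1" by simp
  hence "z \<in> - lerch_cut" using norm_ge_1_if_in_lerch_cut[of z] by auto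
  hence deriv: "(f has_field_derivative deriv f z) (at z)"
    using hol open_Compl_lerch_cut holomorphic_derivI by blast
  define c where "c j = (v + of_nat j) powr (- (s + 1))" for j :: nat
  have "(\<lambda>j. diffs c j * z ^ j) sums deriv f z"
    using sums by (intro termdiffs_sums_strong[OF _ deriv z]) (simp add: c_def)
  hence "(\<lambda>j. z * (diffs c j * z ^ j)) sums (z * deriv f z)" by (rule sums_mult)
  hence "(\<lambda>j. of_nat (Suc j) * c (Suc j) * z ^ Suc j) sums (z * deriv f z)"
    by (simp add: diffs_def algebra_simps)
  \<comment> \<open>The term at \<open>j = 0\<close> vanishes, so the sum starting at 1 is the whole
    sum.\<close>
  hence "(\<lambda>j. of_nat j * c j * z ^ j) sums (z * deriv f z)"
    using sums_Suc[of "\<lambda>j. of_nat j * c j * z ^ j"] by simp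
  moreover have "(\<lambda>j. v * (c j * z ^ j)) sums (v * f z)"
    using sums[OF z] unfolding c_def by (rule sums_mult)
  ultimately have "(\<lambda>j. v * (c j * z ^ j) + of_nat j * c j * z ^ j) sums (v * f z + z * deriv f z)"
    by (intro sums_add)
  also have "(\<lambda>j. v * (c j * z ^ j) + of_nat j * c j * z ^ j) = lerch_term s v z"
  proof
    fix j
    have "(v + of_nat j) * c j = (v + of_nat j) powr (- s)"
      \<comment> \<open>If \<open>v + j = 0\<close>, both sides are 0 because
        \<open>0 powr x = 0\<close>.\<close>
      by (cases "v + of_nat j = 0") (simp_all add: c_def powr_diff)
    moreover have "v * (c j * z ^ j) + of_nat j * c j * z ^ j = (v + of_nat j) * c j * z ^ j"
      by (simp add: algebra_simps)
    ultimately show "v * (c j * z ^ j) + of_nat j * c j * z ^ j = lerch_term s v z j"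
      by (simp add: lerch_term_def)
  qed
  finally show "lerch_term s v z sums (v * f z + z * deriv f z)" .
qed

text \<open>Induction on \<open>N\<close> reaches \<open>Re s > - N\<close> while
  \<open>Re v > 0\<close> is kept, as the integral at the base requires; then induction on
  \<open>M\<close> reaches \<open>Re v > - M\<close> for arbitrary \<open>s\<close>.\<close>

lemma ex_continues_lerch: "\<exists>f. continues_lerch s v f"
proof -
  have v_pos: "\<exists>f. continues_lerch s v f" if "Re s > - of_nat N" "Re v > 0" for s v N
    using that
  proof (induction N arbitrary: s)
    case 0
    thus ?case using continues_lerch_integral by auto
  next
    case (Suc N)
    thus ?case using continues_lerch_shift_s[of s v] Suc.IH[of "s + 1"] by fastforce
  qed
  have "\<exists>f. continues_lerch s v f" if "Re v > - of_nat M" for M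
    using that
  proof (induction M arbitrary: v)
    case 0
    obtain N where "- Re s < of_nat N" using reals_Archimedean2 by blast
    thus ?case using v_pos[of N s v] 0 by auto
  next
    case (Suc M)
    thus ?case using continues_lerch_shift_v[of s v] Suc.IH[of "v + 1"] by fastforce
  qed
  moreover obtain M where "- Re v < of_nat M" using reals_Archimedean2 by blast
  hence "Re v > - of_nat M" by linarith
  ultimately show ?thesis by blast
qed

section \<open>Identifying the function with any continuation\<close>

lemma lerch_continuation_eq:
  assumes f: "continues_lerch s v f" and z: "z \<notin> lerch_cut"
  shows "lerch_continuation s v z = f z"
proof -
  have series: "f w = lerch_series w s v" if "w \<in> ball 0 1" for w
    using f that by (auto simp: continues_lerch_def lerch_series_def lerch_term_def[abs_def] sums_iff)
  define g where "g = lerch_continuation s v"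
  have hol: "f holomorphic_on - lerch_cut" using f by (simp add: continues_lerch_def)
  have g: "g holomorphic_on - lerch_cut \<and> (\<forall>z\<in>ball 0 1. g z = lerch_series z s v)"
    unfolding g_def lerch_continuation_def
    by (rule someI[of _ f]) (simp add: hol series)
  have "{w. w ^ 1 \<notin> lerch_cut} = - lerch_cut" by auto
  hence "g z = f z"
    using eq_on_power_not_in_lerch_cut[of 1 g f z] g hol series z by simp
  thus ?thesis by (simp add: g_def)
qed

text \<open>Uniqueness of the continuation makes all three branches of the definition agree off the
  cut, so no case distinction on \<open>s\<close>, \<open>v\<close> and \<open>norm z\<close>
  remains afterwards.\<close>

lemma hurwitz_lerch_eq:
  assumes f: "continues_lerch s v f" and z: "z \<notin> lerch_cut"
  shows "hurwitz_lerch z s v = f z"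
proof -
  have "z \<noteq> 1" using z by (auto simp: in_lerch_cut_iff)
  moreover have "lerch_series z s v = f z" if "norm z < 1"
    using f that by (auto simp: continues_lerch_def lerch_series_def lerch_term_def[abs_def] sums_iff)
  moreover have "lerch_integral z s v = f z" if "Re s > 0" "Re v > 0"
    using lerch_continuation_eq[OF f z] lerch_continuation_eq[OF continues_lerch_integral[OF that] z]
    by simp
  ultimately show ?thesis
    using lerch_continuation_eq[OF f z] by (auto simp: hurwitz_lerch_def)
qed

section \<open>Multisection by roots of unity\<close>

text \<open>Averaging over the \<open>n\<close>-th roots of unity keeps the terms \<open>w ^ (j + 1)\<close> with
  \<open>j + 1 = n * (l + 1)\<close>; for these the base is \<open>u + j + 1 = n * (u / n + l + 1)\<close>.\<close>

lemma lerch_multisection_sums: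
  fixes n :: nat and u w s \<omega> :: complex
  assumes n: "n > 0" and root: "\<And>j. \<omega> ^ j = 1 \<longleftrightarrow> n dvd j"
    and sums: "\<And>p. p < n \<Longrightarrow> lerch_term s (1 + u) (\<omega> ^ p * w) sums f p"
  shows "(\<lambda>l. of_nat n * of_nat n powr (- s) * w ^ n * lerch_term s (1 + u / of_nat n) (w ^ n) l)
    sums (\<Sum>p<n. \<omega> ^ p * w * f p)"
proof -
  define A where "A j = of_nat (if n dvd Suc j then n else 0) * ((1 + u + of_nat j) powr (- s) * w ^ Suc j)"
    for j
  \<comment> \<open>A geometric sum of an \<open>n\<close>-th root of unity: \<open>n\<close> at the
    root 1, and 0 otherwise.\<close>
  have filter: "(\<Sum>p<n. (\<omega> ^ Suc j) ^ p) = of_nat (if n dvd Suc j then n else 0)" for j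
  proof (cases "n dvd Suc j")
    case True
    hence "\<omega> ^ Suc j = 1" using root by blast
    thus ?thesis using True by (simp del: power_Suc)
  next
    case False
    hence "\<omega> ^ Suc j \<noteq> 1" using root by blast
    moreover have "(\<omega> ^ Suc j) ^ n = 1"
      using root[of "Suc j * n"] by (simp only: power_mult[symmetric]) simp
    ultimately show ?thesis using False geometric_sum[of "\<omega> ^ Suc j" n] by simp
  qed
  have "(\<lambda>j. \<Sum>p<n. \<omega> ^ p * w * lerch_term s (1 + u) (\<omega> ^ p * w) j) sums (\<Sum>p<n. \<omega> ^ p * w * f p)"
    by (intro sums_sum sums_mult sums) auto
  also have "(\<lambda>j. \<Sum>p<n. \<omega> ^ p * w * lerch_term s (1 + u) (\<omega> ^ p * w) j) = A"
  proof
    fix j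
    have "(\<Sum>p<n. \<omega> ^ p * w * lerch_term s (1 + u) (\<omega> ^ p * w) j)
        = (\<Sum>p<n. (\<omega> ^ Suc j) ^ p) * ((1 + u + of_nat j) powr (- s) * w ^ Suc j)"
      unfolding sum_distrib_right lerch_term_def
      by (intro sum.cong) (simp_all add: power_mult_distrib mult_ac flip: power_mult)
    thus "(\<Sum>p<n. \<omega> ^ p * w * lerch_term s (1 + u) (\<omega> ^ p * w) j) = A j"
      unfolding filter A_def .
  qed
  also have "A sums (\<Sum>p<n. \<omega> ^ p * w * f p) \<longleftrightarrow>
      (\<lambda>l. A (n * l + (n - 1))) sums (\<Sum>p<n. \<omega> ^ p * w * f p)"
  \<comment> \<open>The extra factor \<open>\<omega> ^ p * w\<close> raises the exponent to
    \<open>j + 1\<close>, so the surviving indices are \<open>j = n * l + (n - 1)\<close>.\<close>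
  proof (rule sums_mono_reindex[symmetric])
    show "strict_mono (\<lambda>l. n * l + (n - 1))" using n by (intro strict_monoI add_strict_right_mono) simp
    fix j assume j: "j \<notin> range (\<lambda>l. n * l + (n - 1))"
    have "\<not> n dvd Suc j"
    proof
      assume "n dvd Suc j"
      then obtain m where m: "Suc j = n * m" by blast
      then obtain l where "m = Suc l" by (cases m) auto
      hence "j = n * l + (n - 1)" using m n by simp
      thus False using j by blast
    qed
    thus "A j = 0" by (simp add: A_def)
  qed
  also have "(\<lambda>l. A (n * l + (n - 1)))
      = (\<lambda>l. of_nat n * of_nat n powr (- s) * w ^ n * lerch_term s (1 + u / of_nat n) (w ^ n) l)"
  proof
    fix l
    have Suc: "Suc (n * l + (n - 1)) = n * Suc l" using n by simp
    have "1 + u + of_nat (n * l + (n - 1)) = u + of_nat (Suc (n * l + (n - 1)))" by simp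
    also have "\<dots> = of_nat n * (1 + u / of_nat n + of_nat l)"
      unfolding Suc using n by (simp add: field_simps)
    \<comment> \<open>No branch correction arises, since \<open>n\<close> is a nonnegative
      real.\<close>
    also have "\<dots> powr (- s) = of_nat n powr (- s) * (1 + u / of_nat n + of_nat l) powr (- s)"
      by (rule powr_times_real_left) auto
    finally have base: "(1 + u + of_nat (n * l + (n - 1))) powr (- s)
        = of_nat n powr (- s) * (1 + u / of_nat n + of_nat l) powr (- s)" .
    have "w ^ (n * Suc l) = w ^ n * (w ^ n) ^ l"
      by (simp only: mult_Suc_right power_add power_mult)
    thus "A (n * l + (n - 1))
        = of_nat n * of_nat n powr (- s) * w ^ n * lerch_term s (1 + u / of_nat n) (w ^ n) l"
      unfolding A_def lerch_term_def base Suc by simp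
  qed
  finally show ?thesis .
qed

lemma hurwitz_lerch_circle_sums:
  assumes "Re s > 1" "Re v > 0" "norm z = 1"
  shows "lerch_term s v z sums hurwitz_lerch z s v"
  using lerch_term_sums_integral_circle[OF assms] assms by (auto simp: hurwitz_lerch_def)

text \<open>In the unit disc, the argument \<open>z\<close> times the function value at
  \<open>1 + u\<close> is the sum of \<open>(u + j) powr (- s) * z ^ j\<close> over
  \<open>j \<ge> 1\<close>. In this form, keeping the multiples of \<open>n\<close> merely replaces
  \<open>u\<close> by \<open>u / n\<close>.\<close>

lemma hurwitz_lerch_multisection:
  fixes n :: nat and u w s \<omega> :: complex
  assumes n: "n > 0" and root: "\<And>j. \<omega> ^ j = 1 \<longleftrightarrow> n dvd j"
    and def: "\<And>p. p < n \<Longrightarrow> hurwitz_lerch_defined (\<omega> ^ p * w) s (1 + u)"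
    and defn: "hurwitz_lerch_defined (w ^ n) s (1 + u / of_nat n)"
  shows "(\<Sum>p<n. \<omega> ^ p * w * hurwitz_lerch (\<omega> ^ p * w) s (1 + u))
    = of_nat n * of_nat n powr (- s) * w ^ n * hurwitz_lerch (w ^ n) s (1 + u / of_nat n)"
proof -
  have om_n: "\<omega> ^ n = 1" using root by simp
  have om_pow_n: "(\<omega> ^ p) ^ n = 1" for p
    using om_n by (metis mult.commute power_mult power_one)
  have norm_om: "norm \<omega> = 1"
    using power_eq_imp_eq_base[of "norm \<omega>" n 1] n by (simp add: om_n flip: norm_power)
  show ?thesis
  proof (cases "w ^ n \<in> lerch_cut")
    case True
    hence wn: "w ^ n = 1" and s: "Re s > 1" and vn: "Re (1 + u / of_nat n) > 0"
      using defn by (auto simp: hurwitz_lerch_defined_def)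
    have norm_w: "norm w = 1"
      using power_eq_imp_eq_base[of "norm w" n 1] n by (simp add: wn flip: norm_power)
    \<comment> \<open>The \<open>n\<close> distinct powers of \<open>\<omega>\<close> are all the
      \<open>n\<close>-th roots of unity, so one of them is \<open>inverse w\<close>. Definedness at
      that \<open>p\<close> yields \<open>Re (1 + u) > 0\<close>, whereas \<open>vn\<close> says
      only \<open>Re u > - n\<close>.\<close>
    have "\<exists>p<n. \<omega> ^ p * w = 1"
    proof -
      have inj: "inj_on (\<lambda>p. \<omega> ^ p) {..<n}"
      proof (rule linorder_inj_onI')
        fix i j assume ij: "i \<in> {..<n}" "j \<in> {..<n}" "i < j"
        have "\<omega> ^ j = \<omega> ^ i * \<omega> ^ (j - i)" using ij by (simp flip: power_add)
        moreover have "\<omega> ^ (j - i) \<noteq> 1" using root ij by (auto dest: dvd_imp_le)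
        ultimately show "\<omega> ^ i \<noteq> \<omega> ^ j" using norm_om by auto
      qed
      have "(\<lambda>p. \<omega> ^ p) ` {..<n} = {z. z ^ n = 1}"
      proof (rule card_subset_eq)
        show "finite {z::complex. z ^ n = 1}" using n by (intro finite_roots_unity) auto
        show "card ((\<lambda>p. \<omega> ^ p) ` {..<n}) = card {z::complex. z ^ n = 1}"
          using n by (simp add: card_image inj card_roots_unity_eq)
        show "(\<lambda>p. \<omega> ^ p) ` {..<n} \<subseteq> {z. z ^ n = 1}" by (auto simp: om_pow_n)
      qed
      moreover have "inverse w \<in> {z. z ^ n = 1}" using wn by (simp add: power_inverse)
      ultimately have "inverse w \<in> (\<lambda>p. \<omega> ^ p) ` {..<n}" by simp
      thus ?thesis using norm_w by (auto simp: image_iff) (metis left_inverse norm_zero zero_neq_one)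
    qed
    then obtain p where "p < n" "\<omega> ^ p * w = 1" by blast
    hence v: "Re (1 + u) > 0" using def[of p] by (auto simp: hurwitz_lerch_defined_def in_lerch_cut_iff)
    have "(\<lambda>l. of_nat n * of_nat n powr (- s) * w ^ n * lerch_term s (1 + u / of_nat n) (w ^ n) l)
        sums (\<Sum>p<n. \<omega> ^ p * w * hurwitz_lerch (\<omega> ^ p * w) s (1 + u))"
      using n root
      by (intro lerch_multisection_sums hurwitz_lerch_circle_sums s v) (auto simp: norm_mult norm_power norm_om norm_w)
    moreover have "(\<lambda>l. of_nat n * of_nat n powr (- s) * w ^ n * lerch_term s (1 + u / of_nat n) (w ^ n) l)
        sums (of_nat n * of_nat n powr (- s) * w ^ n * hurwitz_lerch (w ^ n) s (1 + u / of_nat n))"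
      by (intro sums_mult hurwitz_lerch_circle_sums s vn) (simp add: wn)
    ultimately show ?thesis by (rule sums_unique2)
  next
    case False
    obtain f g where f: "continues_lerch s (1 + u) f" and g: "continues_lerch s (1 + u / of_nat n) g"
      using ex_continues_lerch by blast
    \<comment> \<open>Rotation by \<open>\<omega> ^ p\<close> does not change the
      \<open>n\<close>-th power, and the cut is closed under \<open>n\<close>-th powers.\<close>
    have cut: "\<omega> ^ p * z \<notin> lerch_cut" if "z ^ n \<notin> lerch_cut" for p z
    proof
      assume c: "\<omega> ^ p * z \<in> lerch_cut"
      then obtain x where x: "x \<ge> 1" "\<omega> ^ p * z = of_real x" by (auto simp: lerch_cut_def)
      have "z ^ n = (\<omega> ^ p * z) ^ n"
        by (simp add: power_mult_distrib om_pow_n)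
      hence "z ^ n = of_real (x ^ n)" by (simp add: x(2))
      thus False using that x(1) by (simp add: in_lerch_cut_iff one_le_power)
    qed
    have "(\<Sum>p<n. \<omega> ^ p * w * f (\<omega> ^ p * w)) = of_nat n * of_nat n powr (- s) * w ^ n * g (w ^ n)"
    proof (rule eq_on_power_not_in_lerch_cut[where f = "\<lambda>w. \<Sum>p<n. \<omega> ^ p * w * f (\<omega> ^ p * w)"
          and g = "\<lambda>w. of_nat n * of_nat n powr (- s) * w ^ n * g (w ^ n)", OF n])
      have "(f \<circ> (\<lambda>w. \<omega> ^ p * w)) holomorphic_on {w. w ^ n \<notin> lerch_cut}" for p
        using f cut unfolding continues_lerch_def
        by (intro holomorphic_on_compose_gen[of _ _ f "- lerch_cut"] holomorphic_intros) auto
      thus "(\<lambda>w. \<Sum>p<n. \<omega> ^ p * w * f (\<omega> ^ p * w)) holomorphic_on {w. w ^ n \<notin> lerch_cut}"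
        by (intro holomorphic_intros) (simp add: o_def)
      have "(g \<circ> (\<lambda>w. w ^ n)) holomorphic_on {w. w ^ n \<notin> lerch_cut}"
        using g unfolding continues_lerch_def
        by (intro holomorphic_on_compose_gen[of _ _ g "- lerch_cut"] holomorphic_intros) auto
      thus "(\<lambda>w. of_nat n * of_nat n powr (- s) * w ^ n * g (w ^ n)) holomorphic_on {w. w ^ n \<notin> lerch_cut}"
        by (intro holomorphic_intros) (simp add: o_def)
      fix w :: complex assume w: "w \<in> ball 0 1"
      have "(\<lambda>l. of_nat n * of_nat n powr (- s) * w ^ n * lerch_term s (1 + u / of_nat n) (w ^ n) l)
          sums (\<Sum>p<n. \<omega> ^ p * w * f (\<omega> ^ p * w))"
        using w f n root
        by (intro lerch_multisection_sums) (auto simp: norm_mult norm_power norm_om continues_lerch_def)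
      moreover have "norm (w ^ n) < 1"
        using w n power_less_one_iff[of "norm w" n] by (simp add: norm_power)
      hence "(\<lambda>l. of_nat n * of_nat n powr (- s) * w ^ n * lerch_term s (1 + u / of_nat n) (w ^ n) l)
          sums (of_nat n * of_nat n powr (- s) * w ^ n * g (w ^ n))"
        using g by (intro sums_mult) (auto simp: continues_lerch_def)
      ultimately show "(\<Sum>p<n. \<omega> ^ p * w * f (\<omega> ^ p * w))
          = of_nat n * of_nat n powr (- s) * w ^ n * g (w ^ n)"
        by (rule sums_unique2)
    qed (rule False)
    thus ?thesis
      using cut[OF False] False hurwitz_lerch_eq[OF f] hurwitz_lerch_eq[OF g] by simp
  qed
qed

text \<open>With \<open>n \<noteq> 2\<close> the prime \<open>n\<close> is odd, so
  \<open>(- exp (2 * \<i> * m)) ^ n\<close> keeps its minus sign. With \<open>\<not> n dvd q\<close>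
  the rotation is by a primitive root; were \<open>q\<close> a multiple of \<open>n\<close>, all
  summands on the left would coincide.\<close>

theorem theorem5p1:
  fixes k a m :: complex and q n :: nat
  assumes "q > 0" and "prime n" and "n \<noteq> q"
    and "n \<noteq> 2" and "\<not> n dvd q"
    and "a \<noteq> 0"
    and "\<And>p. p < n \<Longrightarrow>
      hurwitz_lerch_defined
        (- exp (2 * \<i> * (m + of_nat p * of_real pi * of_nat q / of_nat n)))
        (- k) (1 - 1 / 2 * \<i> * Ln a)"
    and "hurwitz_lerch_defined
        (- exp (2 * \<i> * m * of_nat n)) (- k) (1 - \<i> * Ln a / (2 * of_nat n))"
  shows "(\<Sum>p = 0..n - 1.
      Ln a powr k
      - \<i> powr k * 2 powr (k + 1)
        * exp (2 * \<i> * (m * of_nat n + of_real pi * of_nat p * of_nat q) / of_nat n)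
        * hurwitz_lerch
            (- exp (2 * \<i> * (m + of_nat p * of_real pi * of_nat q / of_nat n)))
            (- k) (1 - 1 / 2 * \<i> * Ln a))
    = of_nat n *
      (Ln a powr k
       - 2 powr (k + 1) * (\<i> * of_nat n) powr k * exp (2 * \<i> * m * of_nat n)
         * hurwitz_lerch
             (- exp (2 * \<i> * m * of_nat n)) (- k) (1 - \<i> * Ln a / (2 * of_nat n)))"
proof -
  have n: "n > 0" using \<open>prime n\<close> by (simp add: prime_gt_0_nat)
  have odd: "odd n" using \<open>prime n\<close> \<open>n \<noteq> 2\<close> prime_odd_nat prime_ge_2_nat
    by (metis le_neq_implies_less)
  define \<omega> where "\<omega> = exp (2 * of_real pi * \<i> * of_nat q / of_nat n)"
  define w where "w = - exp (2 * \<i> * m)"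
  define u where "u = - (\<i> * Ln a / 2)"
  define C where "C = \<i> powr k * 2 powr (k + 1)"
  have om_pow: "\<omega> ^ j = exp (2 * of_real pi * \<i> * of_nat (q * j) / of_nat n)" for j
    unfolding \<omega>_def by (simp add: mult_ac flip: exp_of_nat_mult)
  have root: "\<omega> ^ j = 1 \<longleftrightarrow> n dvd j" for j
    using complex_root_unity_eq_1[of n "q * j"] n \<open>prime n\<close> \<open>\<not> n dvd q\<close>
    unfolding om_pow by (simp add: prime_dvd_mult_iff Suc_le_eq)
  have z: "- exp (2 * \<i> * (m + of_nat p * of_real pi * of_nat q / of_nat n)) = \<omega> ^ p * w" for p
    unfolding om_pow w_def by (simp add: algebra_simps flip: exp_add)
  \<comment> \<open>The exponential prefactor is minus the argument of the function, which is the
    factor that multisection needs.\<close>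
  have e: "exp (2 * \<i> * (m * of_nat n + of_real pi * of_nat p * of_nat q) / of_nat n) = - (\<omega> ^ p * w)" for p
  proof -
    have "2 * \<i> * (m * of_nat n + of_real pi * of_nat p * of_nat q) / of_nat n
        = 2 * \<i> * (m + of_nat p * of_real pi * of_nat q / of_nat n)"
      using n by (simp add: field_simps)
    thus ?thesis by (simp flip: z)
  qed
  have Z: "- exp (2 * \<i> * m * of_nat n) = w ^ n"
    using odd by (simp add: w_def mult_ac flip: exp_of_nat_mult)
  have v: "1 - 1 / 2 * \<i> * Ln a = 1 + u" "1 - \<i> * Ln a / (2 * of_nat n) = 1 + u / of_nat n"
    by (simp_all add: u_def)
  have key: "(\<Sum>p<n. \<omega> ^ p * w * hurwitz_lerch (\<omega> ^ p * w) (- k) (1 + u))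
      = of_nat n * of_nat n powr k * w ^ n * hurwitz_lerch (w ^ n) (- k) (1 + u / of_nat n)"
    using hurwitz_lerch_multisection[OF n root, of w "- k" u] assms(7,8)
    unfolding z Z v by simp
  \<comment> \<open>The power splits without a branch correction because \<open>n\<close> is a
    nonnegative real.\<close>
  have "(\<i> * of_nat n) powr k = of_nat n powr k * \<i> powr k"
    using powr_times_real_left[of "of_nat n" \<i> k] by (simp add: mult.commute)
  hence ik: "2 powr (k + 1) * (\<i> * of_nat n) powr k = C * of_nat n powr k"
    by (simp add: C_def)
  have "{0..n - 1} = {..<n}" using n by auto
  moreover have "(\<Sum>p<n. Ln a powr k - C * - (\<omega> ^ p * w) * hurwitz_lerch (\<omega> ^ p * w) (- k) (1 + u))
      = of_nat n * Ln a powr k + C * (\<Sum>p<n. \<omega> ^ p * w * hurwitz_lerch (\<omega> ^ p * w) (- k) (1 + u))"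
    by (simp add: sum.distrib sum_distrib_left mult_ac)
  moreover have "exp (2 * \<i> * m * of_nat n) = - (w ^ n)" by (simp flip: Z)
  ultimately show ?thesis
    unfolding z e Z v ik key C_def[symmetric] by (simp add: key algebra_simps)
qed

end
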